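(* Let $\Sigma=(G,\sigma)$ be a signed graph. A vector $x\in\mathbb R^{V(\Sigma)}$ belongs to $\mathrm{BTH}(\Sigma)$ if and only if there are real symmetric matrices $M,N$ indexed by $V(\Sigma)$ such that $$\begin{pmatrix} 1 & x^{\mathsf T} \\ x & M \end{pmatrix}\succeq0,\qquad N\succeq0,\qquad M_{vv}=N_{vv}=x_v\quad(v\in V(\Sigma)),$$ and, for every signed edge $e=uv$, $$N_{uv}=\sigma(e)M_{uv}.$$ (If both signs occur between $u$ and $v$, then $M_{uv}=N_{uv}=0$.)
   Context: Signed graphs. A signed graph is a pair $\Sigma=(G,\sigma)$ with $G$ a finite graph and $\sigma:E(G)\to\{+1,-1\}$. Positive loops are allowed, negative loops are excluded; between two distinct vertices there may be both a positive and a negative edge (a digon); repeated edges of the same sign are immaterial. Convention: every signed graph is replaced by its completion having a positive loop at every vertex. Conflict graph. $C(\Sigma)$ is the ordinary simple graph on $V(\Sigma)\times\{\pm1\}$ with $(u,s)\sim(v,r)$ iff there is an edge $e=uv$ of $\Sigma$ (possibly a loop, $u=v$) with $r=-\sigma(e)s$. In particular $(v,+)\sim(v,-)$ for all $v$. Theta body. For a finite simple graph $H$, $\mathrm{TH}(H)=\{x:\exists\, X\text{ symmetric with }\begin{pmatrix} 1 & x^{\mathsf T} \\ x & X \end{pmatrix}\succeq0,\ \operatorname{diag}X=x,\ X_{uv}=0\ (uv\in E(H))\}$. Signed theta body. Let $p:\mathbb R^{V(\Sigma)\times\{\pm1\}}\to\mathbb R^{V(\Sigma)}$, $p(y)_v=y_{(v,+)}+y_{(v,-)}$.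 Then $\mathrm{BTH}(\Sigma)=p(\mathrm{TH}(C(\Sigma)))$. *)

theory Defs
  imports "HOL-Analysis.Analysis" "HOL-Library.Uprod"
begin

section \<open>Signed graphs\<close>

datatype sign = Pos | Neg

instance sign :: finite
proof
  have "(UNIV :: sign set) = {Pos, Neg}"
    using sign.exhaust by blast
  then show "finite (UNIV :: sign set)"
    by (metis finite.emptyI finite.insertI)
qed

fun sval :: "sign \<Rightarrow> real" where
  "sval Pos = 1"
| "sval Neg = -1"

text \<open>
  The vertex set is the whole type \<open>'v\<close> (of class \<open>finite\<close> wherever vectors and matrices
  occur). Edges are named, so that digons and repeated edges are possible; the two ends form an
  unordered pair, and \<open>Upair v v\<close> is the pair of ends of a loop.
\<close>

record ('v, 'e) sgraph =
  edges :: "'e set"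
  ends :: "'e \<Rightarrow> 'v uprod"
  esign :: "'e \<Rightarrow> sign"

definition signed_graph :: "('v, 'e) sgraph \<Rightarrow> bool" where
  "signed_graph G \<longleftrightarrow>
     finite (edges G) \<and> (\<forall>e\<in>edges G. \<forall>v. ends G e = Upair v v \<longrightarrow> esign G e = Pos)"

text \<open>
  The added loop at \<open>v\<close> is the edge \<open>Inr v\<close>; it merely repeats an edge if \<open>v\<close> already has a
  positive loop.
\<close>

definition completion :: "('v, 'e) sgraph \<Rightarrow> ('v, 'e + 'v) sgraph" where
  "completion G =
     \<lparr> edges = Inl ` edges G \<union> range Inr,
       ends = case_sum (ends G) (\<lambda>v. Upair v v),
       esign = case_sum (esign G) (\<lambda>v. Pos) \<rparr>"

lemma signed_graph_completion:
  fixes G :: "('v::finite, 'e) sgraph"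
  shows "signed_graph G \<Longrightarrow> signed_graph (completion G)"
  by (auto simp: signed_graph_def completion_def)

text \<open>A simple graph is given by its adjacency predicate, symmetric and irreflexive.\<close>

definition conflict_graph :: "('v, 'e) sgraph \<Rightarrow> 'v \<times> sign \<Rightarrow> 'v \<times> sign \<Rightarrow> bool" where
  "conflict_graph G = (\<lambda>(u, s) (v, r).
     \<exists>e\<in>edges G. ends G e = Upair u v \<and> sval r = - sval (esign G e) * sval s)"

lemma symp_conflict_graph: "symp (conflict_graph G)"
proof (rule sympI)
  fix a b
  assume ab: "conflict_graph G a b"
  obtain u s v r where [simp]: "a = (u, s)" "b = (v, r)"
    by (cases a; cases b)
  obtain e where e: "e \<in> edges G" "ends G e = Upair u v" "sval r = - sval (esign G e) * sval s"
    using ab by (auto simp: conflict_graph_def)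
  have "ends G e = Upair v u"
    using e(2) by auto
  moreover have "sval s = - sval (esign G e) * sval r"
    using e(3) by (cases "esign G e"; cases s; cases r) auto
  ultimately show "conflict_graph G b a"
    using e(1) by (auto simp: conflict_graph_def)
qed

lemma irreflp_conflict_graph: "signed_graph G \<Longrightarrow> irreflp (conflict_graph G)"
proof (rule irreflpI)
  fix a
  assume "signed_graph G"
  then show "\<not> conflict_graph G a a"
    by (cases a; cases "snd a") (auto simp: conflict_graph_def signed_graph_def)
qed

lemma conflict_graph_completion_vertex:
  "conflict_graph (completion G) (v, Pos) (v, Neg)"
  by (auto simp: conflict_graph_def completion_def intro!: bexI[of _ "Inr v"])

section \<open>Theta bodies\<close>

definition psd :: "real ^ 'n ^ 'n \<Rightarrow> bool" where
  "psd A \<longleftrightarrow> transpose A = A \<and> (\<forall>z. 0 \<le> z \<bullet> (A *v z))"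

text \<open>The block matrix with rows \<open>(1, x\<^sup>T)\<close> and \<open>(x, X)\<close>; the extra index is \<open>None\<close>.\<close>

definition bordered :: "real ^ 'n \<Rightarrow> real ^ 'n ^ 'n \<Rightarrow> real ^ 'n option ^ 'n option" where
  "bordered x X = (\<chi> i j. case (i, j) of
       (None, None) \<Rightarrow> 1
     | (None, Some v) \<Rightarrow> x $ v
     | (Some u, None) \<Rightarrow> x $ u
     | (Some u, Some v) \<Rightarrow> X $ u $ v)"

definition TH :: "('n \<Rightarrow> 'n \<Rightarrow> bool) \<Rightarrow> (real ^ 'n) set" where
  "TH H = {x. \<exists>X. transpose X = X \<and> psd (bordered x X) \<and>
     (\<forall>v. X $ v $ v = x $ v) \<and> (\<forall>u v. H u v \<longrightarrow> X $ u $ v = 0)}"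

definition proj :: "real ^ ('v \<times> sign) \<Rightarrow> real ^ 'v" where
  "proj y = (\<chi> v. y $ (v, Pos) + y $ (v, Neg))"

definition BTH :: "('v, 'e) sgraph \<Rightarrow> (real ^ 'v) set" where
  "BTH G = proj ` TH (conflict_graph (completion G))"

end

theory Submission
  imports Defs
begin

text \<open>
  A certificate \<open>Y\<close> for the conflict graph is compressed along \<open>(v, s) \<mapsto> v\<close> with the two
  weights \<open>1\<close> and \<open>s\<close>, which yields \<open>M\<close> and \<open>N\<close>; the zeros of \<open>Y\<close> on conflict edges become
  \<open>N\<^sub>u\<^sub>v = \<sigma>(e) M\<^sub>u\<^sub>v\<close>. Conversely, \<open>Y = (M\<^sub>u\<^sub>v + s r N\<^sub>u\<^sub>v) / 4\<close> is the certificate that is invariant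
  under switching all signs at once, and its quadratic form splits into those of \<open>M\<close> and \<open>N\<close>.
\<close>

lemma UNIV_sign: "(UNIV :: sign set) = {Pos, Neg}"
  using sign.exhaust by blast

lemma sum_UNIV_sign: "(\<Sum>s\<in>UNIV. f s) = f Pos + f Neg"
  by (simp add: UNIV_sign)

lemma sum_UNIV_option:
  fixes f :: "'a::finite option \<Rightarrow> 'b::comm_monoid_add"
  shows "(\<Sum>i\<in>UNIV. f i) = f None + (\<Sum>v\<in>UNIV. f (Some v))"
  by (simp add: UNIV_option_conv sum.reindex)

lemma sum_UNIV_pair:
  fixes f :: "'a::finite \<times> 'b::finite \<Rightarrow> 'c::comm_monoid_add"
  shows "(\<Sum>p\<in>UNIV. f p) = (\<Sum>a\<in>UNIV. \<Sum>b\<in>UNIV. f (a, b))"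
  by (simp add: sum.cartesian_product flip: UNIV_Times_UNIV)

lemma inner_matrix_vector:
  fixes A :: "real ^ 'n ^ 'n"
  shows "z \<bullet> (A *v z) = (\<Sum>i\<in>UNIV. \<Sum>j\<in>UNIV. z $ i * A $ i $ j * z $ j)"
  by (simp add: inner_vec_def matrix_vector_mult_def sum_distrib_left mult.assoc)

lemma transpose_eq_iff: "transpose A = A \<longleftrightarrow> (\<forall>i j. A $ i $ j = A $ j $ i)"
  by (auto simp: transpose_def vec_eq_iff)

lemma quadratic_form_bordered:
  fixes x :: "real ^ 'n"
  shows "z \<bullet> (bordered x X *v z) =
    (z $ None)\<^sup>2 + 2 * z $ None * ((\<chi> v. z $ Some v) \<bullet> x)
      + (\<chi> v. z $ Some v) \<bullet> (X *v (\<chi> v. z $ Some v))"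
  unfolding inner_matrix_vector
  by (simp add: sum_UNIV_option bordered_def sum.distrib power2_eq_square
      inner_vec_def sum_distrib_left algebra_simps)

lemma transpose_bordered_eq_iff:
  "transpose (bordered x X) = bordered x X \<longleftrightarrow> transpose X = X"
  by (auto simp: transpose_eq_iff bordered_def split: option.split)

text \<open>A vector indexed by the option type is a scalar \<open>t\<close> together with a vector
  \<open>a\<close>. In this form later arguments compare quadratic forms over the original indices
  and never meet \<open>None\<close>.\<close>

lemma psd_bordered_iff:
  fixes x :: "real ^ 'n"
  shows "psd (bordered x X) \<longleftrightarrow>
    transpose X = X \<and> (\<forall>t a. 0 \<le> t\<^sup>2 + 2 * t * (a \<bullet> x) + a \<bullet> (X *v a))"
proof -
  have "(\<forall>z. 0 \<le> z \<bullet> (bordered x X *v z)) \<longleftrightarrow>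
      (\<forall>t a. 0 \<le> t\<^sup>2 + 2 * t * (a \<bullet> x) + a \<bullet> (X *v a))" (is "?L \<longleftrightarrow> ?R")
  proof
    assume L: ?L
    show ?R
    proof (intro allI)
      fix t a
      show "0 \<le> t\<^sup>2 + 2 * t * (a \<bullet> x) + a \<bullet> (X *v a)"
        using L[rule_format, of "\<chi> i. case i of None \<Rightarrow> t | Some v \<Rightarrow> a $ v"]
        by (simp add: quadratic_form_bordered)
    qed
  next
    assume ?R
    then show ?L
      by (simp add: quadratic_form_bordered)
  qed
  then show ?thesis
    by (simp add: psd_def transpose_bordered_eq_iff)
qed

text \<open>The case \<open>t = 0\<close> of the bordered form, that is, passage to a principal
  submatrix.\<close>

lemma psd_of_psd_bordered:
  assumes "psd (bordered x X)"
  shows "psd X"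
proof -
  have "0 \<le> a \<bullet> (X *v a)" for a
    using assms[unfolded psd_bordered_iff, THEN conjunct2, rule_format, of 0 a] by simp
  moreover have "transpose X = X"
    using assms by (simp add: psd_bordered_iff)
  ultimately show ?thesis
    by (simp add: psd_def)
qed

definition sign_lift :: "(sign \<Rightarrow> real) \<Rightarrow> real ^ 'v \<Rightarrow> real ^ ('v \<times> sign)" where
  "sign_lift f a = (\<chi> p. f (snd p) * a $ fst p)"

text \<open>This is the congruence \<open>L^T Y L\<close>, where \<open>L\<close> is the matrix of
  the linear map \<open>sign_lift f\<close>; hence it preserves positive semidefiniteness.\<close>

definition sign_compress ::
    "(sign \<Rightarrow> real) \<Rightarrow> real ^ ('v \<times> sign) ^ ('v \<times> sign) \<Rightarrow> real ^ 'v ^ 'v" where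
  "sign_compress f Y = (\<chi> u v. \<Sum>s\<in>UNIV. \<Sum>r\<in>UNIV. f s * f r * Y $ (u, s) $ (v, r))"

lemma quadratic_form_sign_compress:
  fixes a :: "real ^ 'v::finite"
  shows "a \<bullet> (sign_compress f Y *v a) = sign_lift f a \<bullet> (Y *v sign_lift f a)"
  unfolding inner_matrix_vector
  by (simp add: sum_UNIV_pair sum_UNIV_sign sign_lift_def sign_compress_def
      sum.distrib algebra_simps)

lemma transpose_sign_compress:
  "transpose Y = Y \<Longrightarrow> transpose (sign_compress f Y) = sign_compress f Y"
  by (simp add: transpose_eq_iff sign_compress_def sum_UNIV_sign algebra_simps)

lemma psd_sign_compress:
  fixes Y :: "real ^ ('v::finite \<times> sign) ^ ('v \<times> sign)"
  shows "psd Y \<Longrightarrow> psd (sign_compress f Y)"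
  by (simp add: psd_def transpose_sign_compress quadratic_form_sign_compress)

text \<open>\<open>proj\<close> is the adjoint of the lift with weight \<open>1\<close>, so the
  border is projected correctly when \<open>Y\<close> is compressed with that weight.\<close>

lemma sign_lift_inner:
  fixes a :: "real ^ 'v::finite"
  shows "sign_lift (\<lambda>_. 1) a \<bullet> y = a \<bullet> proj y"
  by (simp add: inner_vec_def sum_UNIV_pair sum_UNIV_sign sign_lift_def proj_def algebra_simps)

text \<open>The bordered form of the compression at \<open>t\<close>, \<open>a\<close> is the
  bordered form of \<open>Y\<close> at \<open>t\<close> and the lift of \<open>a\<close>.\<close>

lemma psd_bordered_sign_compress:
  fixes y :: "real ^ ('v::finite \<times> sign)"
  assumes "psd (bordered y Y)"
  shows "psd (bordered (proj y) (sign_compress (\<lambda>_. 1) Y))"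
  using assms
  by (simp add: psd_bordered_iff transpose_sign_compress quadratic_form_sign_compress
      flip: sign_lift_inner)

text \<open>Compressing this matrix with the weights \<open>1\<close> and \<open>sval\<close> gives
  back \<open>M\<close> and \<open>N\<close>, which explains the division by 4.\<close>

definition sign_expand ::
    "real ^ 'v ^ 'v \<Rightarrow> real ^ 'v ^ 'v \<Rightarrow> real ^ ('v \<times> sign) ^ ('v \<times> sign)" where
  "sign_expand M N =
     (\<chi> p q. (M $ fst p $ fst q + sval (snd p) * sval (snd q) * N $ fst p $ fst q) / 4)"

text \<open>The entry of \<open>z\<close> at \<open>(v, s)\<close> is \<open>a + s b\<close>, with
  \<open>a\<close> even and \<open>b\<close> odd under swapping the two signs. \<open>M\<close> sees
  only the even part and \<open>N\<close> only the odd part, so no cross terms remain.\<close>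

lemma quadratic_form_sign_expand:
  fixes M N :: "real ^ 'v::finite ^ 'v"
  defines "a z \<equiv> (\<chi> v. (z $ (v, Pos) + z $ (v, Neg)) / 2)"
    and "b z \<equiv> (\<chi> v. (z $ (v, Pos) - z $ (v, Neg)) / 2)"
  shows "z \<bullet> (sign_expand M N *v z) = a z \<bullet> (M *v a z) + b z \<bullet> (N *v b z)"
  unfolding inner_matrix_vector a_def b_def
  \<comment> \<open>All sums are merged into one double sum over pairs of vertices, so that the
    identity can be checked summand by summand.\<close>
  by (simp only: sum_UNIV_pair sum_UNIV_sign sign_expand_def flip: sum.distrib)
    (intro sum.cong refl, simp, simp add: field_simps)

text \<open>The lifted point has equal values at both signs. So the linear term involves only the
  even part of \<open>z\<close> and joins the form of \<open>M\<close>, while \<open>N\<close> needs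
  no border.\<close>

lemma psd_bordered_sign_expand:
  fixes x :: "real ^ 'v::finite"
  assumes M: "psd (bordered x M)" and N: "psd N"
  shows "psd (bordered (sign_lift (\<lambda>_. 1 / 2) x) (sign_expand M N))"
proof -
  have "transpose (sign_expand M N) = sign_expand M N"
    using psd_of_psd_bordered[OF M] N by (simp add: psd_def transpose_eq_iff sign_expand_def)
  moreover have "0 \<le> t\<^sup>2 + 2 * t * (z \<bullet> sign_lift (\<lambda>_. 1 / 2) x) + z \<bullet> (sign_expand M N *v z)"
    for t z
  proof -
    let ?a = "(\<chi> v. (z $ (v, Pos) + z $ (v, Neg)) / 2) :: real ^ 'v"
    let ?b = "(\<chi> v. (z $ (v, Pos) - z $ (v, Neg)) / 2) :: real ^ 'v"
    have "z \<bullet> sign_lift (\<lambda>_. 1 / 2) x = ?a \<bullet> x"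
      by (simp add: inner_vec_def sum_UNIV_pair sum_UNIV_sign sign_lift_def field_simps)
    moreover have "0 \<le> t\<^sup>2 + 2 * t * (?a \<bullet> x) + ?a \<bullet> (M *v ?a)"
      using M by (simp only: psd_bordered_iff)
    moreover have "0 \<le> ?b \<bullet> (N *v ?b)"
      using N by (simp only: psd_def)
    ultimately show ?thesis
      by (simp add: quadratic_form_sign_expand)
  qed
  ultimately show ?thesis
    by (simp add: psd_bordered_iff)
qed

text \<open>Separates the conflicts caused by the added loops, so that the edge conditions need to
  range over the edges of \<open>G\<close> only.\<close>

lemma conflict_graph_completion_iff:
  "conflict_graph (completion G) (u, s) (v, r) \<longleftrightarrow>
     conflict_graph G (u, s) (v, r) \<or> u = v \<and> s \<noteq> r"
proof -
  have "sval r = - sval s \<longleftrightarrow> s \<noteq> r"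
    by (cases s; cases r) auto
  then show ?thesis
    by (auto simp: conflict_graph_def completion_def bex_Un image_iff)
qed

theorem theorem7p2:
  fixes G :: "('v::finite, 'e) sgraph" and x :: "real ^ 'v"
  assumes "signed_graph G"
  shows "(x \<in> BTH G \<longleftrightarrow>
      (\<exists>M N :: real ^ 'v ^ 'v.
         transpose M = M \<and> transpose N = N \<and>
         psd (bordered x M) \<and> psd N \<and>
         (\<forall>v. M $ v $ v = x $ v \<and> N $ v $ v = x $ v) \<and>
         (\<forall>e\<in>edges G. \<forall>u v. ends G e = Upair u v \<longrightarrow>
            N $ u $ v = sval (esign G e) * M $ u $ v)))
    \<and> (\<forall>M N :: real ^ 'v ^ 'v.
         (\<forall>e\<in>edges G. \<forall>u v. ends G e = Upair u v \<longrightarrow>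
            N $ u $ v = sval (esign G e) * M $ u $ v) \<longrightarrow>
         (\<forall>e\<in>edges G. \<forall>f\<in>edges G. \<forall>u v.
            ends G e = Upair u v \<and> ends G f = Upair u v \<and>
            esign G e = Pos \<and> esign G f = Neg \<longrightarrow>
            M $ u $ v = 0 \<and> N $ u $ v = 0))"
proof (intro conjI iffI)
  assume "x \<in> BTH G"
  then obtain y where x: "x = proj y" and "y \<in> TH (conflict_graph (completion G))"
    unfolding BTH_def by blast
  then obtain Y where psd: "psd (bordered y Y)"
    and diag: "\<forall>p. Y $ p $ p = y $ p"
    and zero: "\<forall>p q. conflict_graph (completion G) p q \<longrightarrow> Y $ p $ q = 0"
    unfolding TH_def by blast
  let ?M = "sign_compress (\<lambda>_. 1) Y" and ?N = "sign_compress sval Y"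
  have "psd ?N"
    using psd by (rule psd_sign_compress[OF psd_of_psd_bordered])
  moreover have "psd (bordered x ?M)"
    using psd by (simp add: x psd_bordered_sign_compress)
  moreover have "transpose ?M = ?M" "transpose ?N = ?N"
    using psd by (simp_all add: psd_bordered_iff transpose_sign_compress)
  \<comment> \<open>The two off-diagonal entries vanish by the added loop at \<open>v\<close>, and
    the remaining ones have weight 1 in both compressions.\<close>
  moreover have "?M $ v $ v = x $ v \<and> ?N $ v $ v = x $ v" for v
    using zero[rule_format, of "(v, Pos)" "(v, Neg)"] zero[rule_format, of "(v, Neg)" "(v, Pos)"]
    by (simp add: conflict_graph_completion_iff sign_compress_def sum_UNIV_sign diag x proj_def)
  \<comment> \<open>The difference of the two sides is the sum of \<open>(s r - \<sigma>(e))\<close>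
    times the entry of \<open>Y\<close> at \<open>(u, s)\<close>, \<open>(v, r)\<close>. The factor
    is nonzero only if \<open>r = - \<sigma>(e) s\<close>, and there \<open>Y\<close>
    vanishes.\<close>
  moreover have "?N $ u $ v = sval (esign G e) * ?M $ u $ v"
    if "e \<in> edges G" "ends G e = Upair u v" for e u v
  proof -
    have "Y $ (u, s) $ (v, r) = 0" if "sval r = - sval (esign G e) * sval s" for s r
    proof -
      have "conflict_graph G (u, s) (v, r)"
        using \<open>e \<in> edges G\<close> \<open>ends G e = Upair u v\<close> that by (auto simp: conflict_graph_def)
      then show ?thesis
        using zero by (simp add: conflict_graph_completion_iff)
    qed
    then show ?thesis
      by (cases "esign G e") (simp_all add: sign_compress_def sum_UNIV_sign)
  qed
  ultimately show "\<exists>M N :: real ^ 'v ^ 'v.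
         transpose M = M \<and> transpose N = N \<and>
         psd (bordered x M) \<and> psd N \<and>
         (\<forall>v. M $ v $ v = x $ v \<and> N $ v $ v = x $ v) \<and>
         (\<forall>e\<in>edges G. \<forall>u v. ends G e = Upair u v \<longrightarrow>
            N $ u $ v = sval (esign G e) * M $ u $ v)"
    by blast
next
  assume "\<exists>M N :: real ^ 'v ^ 'v.
         transpose M = M \<and> transpose N = N \<and>
         psd (bordered x M) \<and> psd N \<and>
         (\<forall>v. M $ v $ v = x $ v \<and> N $ v $ v = x $ v) \<and>
         (\<forall>e\<in>edges G. \<forall>u v. ends G e = Upair u v \<longrightarrow>
            N $ u $ v = sval (esign G e) * M $ u $ v)"
  then obtain M N :: "real ^ 'v ^ 'v" where psd: "psd (bordered x M)" "psd N"
    and diag: "\<And>v. M $ v $ v = x $ v" "\<And>v. N $ v $ v = x $ v"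
    and edge: "\<And>e u v. e \<in> edges G \<Longrightarrow> ends G e = Upair u v \<Longrightarrow>
            N $ u $ v = sval (esign G e) * M $ u $ v"
    by blast
  \<comment> \<open>Each vertex splits its value evenly between its two signs, so
    \<open>proj\<close> returns \<open>x\<close>.\<close>
  let ?y = "sign_lift (\<lambda>_. 1 / 2) x" and ?Y = "sign_expand M N"
  have "psd (bordered ?y ?Y)"
    using psd by (rule psd_bordered_sign_expand)
  moreover from this have "transpose ?Y = ?Y"
    by (simp add: psd_bordered_iff)
  moreover have "?Y $ (v, s) $ (v, s) = ?y $ (v, s)" for v s
    by (cases s) (simp_all add: sign_expand_def sign_lift_def diag)
  moreover have "?Y $ (u, s) $ (v, r) = 0"
    if "conflict_graph (completion G) (u, s) (v, r)" for u s v r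
  proof (cases "conflict_graph G (u, s) (v, r)")
    case True
    then obtain e where e: "e \<in> edges G" "ends G e = Upair u v"
        "sval r = - sval (esign G e) * sval s"
      by (auto simp: conflict_graph_def)
    \<comment> \<open>Here \<open>s r = - \<sigma>(e)\<close>, so the edge equation turns
      \<open>s r N\<close> into \<open>- M\<close>.\<close>
    then show ?thesis
      using edge[OF e(1,2)]
      by (cases "esign G e"; cases s) (simp_all add: sign_expand_def)
  next
    case False
    \<comment> \<open>On a pair added by the completion the entry is a multiple of
      \<open>M - N\<close> on the diagonal, where both matrices equal \<open>x\<close>.\<close>
    then show ?thesis
      using that
      by (cases s; cases r) (auto simp: conflict_graph_completion_iff sign_expand_def diag)
  qed
  ultimately have "?y \<in> TH (conflict_graph (completion G))"
    unfolding TH_def by (auto intro!: exI[of _ ?Y])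
  moreover have "x = proj ?y"
    by (simp add: proj_def sign_lift_def vec_eq_iff)
  ultimately show "x \<in> BTH G"
    unfolding BTH_def by blast
next
  show "\<forall>M N :: real ^ 'v ^ 'v.
         (\<forall>e\<in>edges G. \<forall>u v. ends G e = Upair u v \<longrightarrow>
            N $ u $ v = sval (esign G e) * M $ u $ v) \<longrightarrow>
         (\<forall>e\<in>edges G. \<forall>f\<in>edges G. \<forall>u v.
            ends G e = Upair u v \<and> ends G f = Upair u v \<and>
            esign G e = Pos \<and> esign G f = Neg \<longrightarrow>
            M $ u $ v = 0 \<and> N $ u $ v = 0)"
  proof (intro allI impI ballI, elim conjE)
    fix M N :: "real ^ 'v ^ 'v" and e f u v
    assume edge: "\<forall>e\<in>edges G. \<forall>u v. ends G e = Upair u v \<longrightarrow>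
        N $ u $ v = sval (esign G e) * M $ u $ v"
      and e: "e \<in> edges G" "ends G e = Upair u v" "esign G e = Pos"
      and f: "f \<in> edges G" "ends G f = Upair u v" "esign G f = Neg"
    have "N $ u $ v = M $ u $ v"
      using edge[rule_format, OF e(1,2)] e(3) by simp
    moreover have "N $ u $ v = - M $ u $ v"
      using edge[rule_format, OF f(1,2)] f(3) by simp
    ultimately show "M $ u $ v = 0 \<and> N $ u $ v = 0"
      by simp
  qed
qed

end
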